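(* Let $-\infty<a<b<\infty$. I. Let $\alpha>0$ be arbitrary and let $f\in C^{\lceil\alpha\rceil-1}[a,b]$ be continuously Caputo $\alpha$-differentiable. Then: (i) For any $0<\beta<\alpha$, $f$ is continuously Caputo $\beta$-differentiable with continuous derivative $f_1:={}^{C}D_a^{\beta}f\in C[a,b]$. Furthermore, if $\beta\notin\mathbb{N}$ then $({}^{C}D_a^{\beta}f)(a)=0$. (ii) For any $0<\beta<\alpha$ and any $0<\gamma\le 1$ such that $\beta+\gamma\le\alpha$ and $\lceil\beta+\gamma\rceil-\lfloor\beta\rfloor=1$, the continuous Caputo $\beta$-derivative $f_1={}^{C}D_a^{\beta}f$ is continuously Caputo $\gamma$-differentiable, and ${}^{C}D_a^{\gamma}f_1={}^{C}D_a^{\beta+\gamma}f$; thus ${}^{C}D_a^{\gamma}\,{}^{C}D_a^{\beta}f={}^{C}D_a^{\beta+\gamma}f$. II. Conversely, let $\beta>0$ and $0<\gamma\le 1$ be such that $\lceil\beta+\gamma\rceil-\lfloor\beta\rfloor=1$. Assume that a function $h\in C^{\lceil\beta\rceil-1}[a,b]$ is continuously Caputo $\beta$-differentiable and that $h_1:={}^{C}D_a^{\beta}h$ is continuously Caputo $\gamma$-differentiable, and assume additionally that $h_1(a)=0$ if $\beta\notin\mathbb{N}$. Then $h$ is continuously Caputo $(\beta+\gamma)$-differentiable, and ${}^{C}D_a^{\gamma}h_1={}^{C}D_a^{\beta+\gamma}h$; thus ${}^{C}D_a^{\gamma}({}^{C}D_a^{\beta}h)={}^{C}D_a^{\beta+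\gamma}h$.
   Context: Let $[a,b]\subset\mathbb{R}$, $-\infty<a<b<\infty$. For $\alpha>0$ the Riemann-Liouville fractional integral operator is $J_a^\alpha f(x):=\frac{1}{\Gamma(\alpha)}\int_a^x (x-t)^{\alpha-1}f(t)\,dt$ for $a\le x\le b$; $J_a^0$ is the identity. $D^m$ denotes the ordinary derivative of integer order $m$. For $\alpha>0$ and $m:=\lceil\alpha\rceil$ put ${}^{RL}D_a^{\alpha}f:=D^mJ_a^{m-\alpha}f$ (Riemann-Liouville derivative). For $\alpha>0$, $m:=\lceil\alpha\rceil$ and $f\in C^{m-1}[a,b]$, the Caputo fractional derivative of order $\alpha$ is ${}^{C}D_a^{\alpha}f:={}^{RL}D_a^{\alpha}(f-T_{m-1}[f;a])$, where $T_{m-1}[f;a](t):=\sum_{k=0}^{m-1}\frac{(D^kf)(a)}{k!}(t-a)^k$. A function $f\in C^{m-1}[a,b]$ is called continuously Caputo $\alpha$-differentiable if ${}^{C}D_a^{\alpha}f$ exists and belongs to $C[a,b]$. *)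

theory Defs
  imports "HOL-Analysis.Analysis"
begin

text \<open>
  Functions on the compact interval \<open>[a, b]\<close> are represented by total functions of which only the
  values on \<open>{a..b}\<close> matter.  Derivatives are taken within \<open>{a..b}\<close>, hence are one-sided at the end
  points; they are unique because \<open>a < b\<close>.
\<close>

primrec nth_deriv :: "real \<Rightarrow> real \<Rightarrow> nat \<Rightarrow> (real \<Rightarrow> real) \<Rightarrow> real \<Rightarrow> real" where
  "nth_deriv a b 0 f = f"
| "nth_deriv a b (Suc n) f =
     (\<lambda>x. vector_derivative (nth_deriv a b n f) (at x within {a..b}))"

definition times_differentiable :: "real \<Rightarrow> real \<Rightarrow> nat \<Rightarrow> (real \<Rightarrow> real) \<Rightarrow> bool" where
  "times_differentiable a b n f \<longleftrightarrow>
     (\<forall>k<n. \<forall>x\<in>{a..b}. nth_deriv a b k f differentiable (at x within {a..b}))"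

definition C_class :: "real \<Rightarrow> real \<Rightarrow> nat \<Rightarrow> (real \<Rightarrow> real) \<Rightarrow> bool" where
  "C_class a b n f \<longleftrightarrow>
     times_differentiable a b n f \<and> continuous_on {a..b} (nth_deriv a b n f)"

text \<open>
  The Lebesgue integral below is only used for \<open>f\<close> continuous on \<open>{a..b}\<close> and \<open>a \<le> x \<le> b\<close>, where the
  integrand is absolutely integrable for every \<open>\<alpha> > 0\<close>.  The convention \<open>0 powr y = 0\<close> affects it
  only at the single point \<open>t = x\<close>.
\<close>

definition RL_integral :: "real \<Rightarrow> real \<Rightarrow> (real \<Rightarrow> real) \<Rightarrow> real \<Rightarrow> real" where
  "RL_integral a \<alpha> f x =
     (if \<alpha> = 0 then f x
      else 1 / Gamma \<alpha> * (LBINT t:{a..x}. (x - t) powr (\<alpha> - 1) * f t))"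

definition RL_deriv :: "real \<Rightarrow> real \<Rightarrow> real \<Rightarrow> (real \<Rightarrow> real) \<Rightarrow> real \<Rightarrow> real" where
  "RL_deriv a b \<alpha> f =
     (let m = nat \<lceil>\<alpha>\<rceil> in nth_deriv a b m (RL_integral a (real m - \<alpha>) f))"

definition RL_differentiable :: "real \<Rightarrow> real \<Rightarrow> real \<Rightarrow> (real \<Rightarrow> real) \<Rightarrow> bool" where
  "RL_differentiable a b \<alpha> f \<longleftrightarrow>
     (let m = nat \<lceil>\<alpha>\<rceil> in times_differentiable a b m (RL_integral a (real m - \<alpha>) f))"

definition taylor_poly :: "real \<Rightarrow> real \<Rightarrow> nat \<Rightarrow> (real \<Rightarrow> real) \<Rightarrow> real \<Rightarrow> real" where
  "taylor_poly a b n f t = (\<Sum>k\<le>n. nth_deriv a b k f a / fact k * (t - a) ^ k)"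

text \<open>For \<open>\<alpha> > 0\<close> we have \<open>\<lceil>\<alpha>\<rceil> \<ge> 1\<close>, so the subtraction \<open>nat \<lceil>\<alpha>\<rceil> - 1\<close> does not truncate.\<close>

definition caputo_deriv :: "real \<Rightarrow> real \<Rightarrow> real \<Rightarrow> (real \<Rightarrow> real) \<Rightarrow> real \<Rightarrow> real" where
  "caputo_deriv a b \<alpha> f =
     RL_deriv a b \<alpha> (\<lambda>t. f t - taylor_poly a b (nat \<lceil>\<alpha>\<rceil> - 1) f t)"

definition cont_caputo_differentiable ::
    "real \<Rightarrow> real \<Rightarrow> real \<Rightarrow> (real \<Rightarrow> real) \<Rightarrow> bool" where
  "cont_caputo_differentiable a b \<alpha> f \<longleftrightarrow>
     C_class a b (nat \<lceil>\<alpha>\<rceil> - 1) f \<and>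
     RL_differentiable a b \<alpha> (\<lambda>t. f t - taylor_poly a b (nat \<lceil>\<alpha>\<rceil> - 1) f t) \<and>
     continuous_on {a..b} (caputo_deriv a b \<alpha> f)"

end

theory Submission
  imports Defs
begin

text \<open>
  Everything reduces to one characterisation: a function \<open>f\<close> of class \<open>C\<^sup>m\<^sup>-\<^sup>1\<close> with
  \<open>m = \<lceil>\<alpha>\<rceil>\<close> has the continuous Caputo derivative \<open>\<phi>\<close> of order \<open>\<alpha>\<close> iff it solves
  \<open>f = T + J\<^sup>\<alpha> \<phi>\<close>, where \<open>T\<close> is its Taylor polynomial of degree \<open>m - 1\<close>.  With the semigroup law
  \<open>J\<^sup>\<alpha> J\<^sup>\<beta> = J\<^sup>\<alpha>\<^sup>+\<^sup>\<beta>\<close> (Fubini and the Beta integral) and the injectivity of \<open>J\<^sup>\<alpha>\<close> on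
  continuous functions, passing between orders becomes algebra with these integral equations.
\<close>

subsection \<open>Convolution with the Riemann--Liouville kernel\<close>

text \<open>The delicate half of the characterisation recovers \<open>f\<close> from
  \<open>D^m J^(m-\<alpha>) (f - T) = \<phi>\<close>: undoing \<open>D^m\<close> outright would
  leave m unknown constants. Because \<open>f\<close> is of class C^(m-1), the remainder
  \<open>f - T\<close> is itself an (m-1)-fold integral, so only one differentiation has to be
  undone, and its single constant is a value at \<open>a\<close> that vanishes.

  The side conditions come from constants. \<open>J^\<beta>\<close> sends a constant
  \<open>c\<close> to \<open>c (x - a)^\<beta> / Gamma (\<beta> + 1)\<close>: for natural \<beta>
  this is a Taylor term, for fractional \<beta> no Taylor polynomial can absorb it. Hence the value
  of the \<beta>-derivative at \<open>a\<close> is the next derivative of \<open>f\<close> at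
  \<open>a\<close> in the first case and must be 0 in the second. The condition on ceiling and floor
  keeps \<beta> + \<gamma> from passing the next integer after \<beta>, so no other Taylor term
  intervenes.\<close>

definition rl_kernel :: "real \<Rightarrow> real \<Rightarrow> real" where
  "rl_kernel \<alpha> u = (if u > 0 then u powr (\<alpha> - 1) / Gamma \<alpha> else 0)"

lemma borel_measurable_rl_kernel [measurable]: "rl_kernel \<alpha> \<in> borel_measurable borel"
  unfolding rl_kernel_def [abs_def] by measurable

lemma rl_kernel_nonneg: "\<alpha> > 0 \<Longrightarrow> 0 \<le> rl_kernel \<alpha> u"
  by (simp add: rl_kernel_def Gamma_real_nonneg)

text \<open>The singularity at 0 is integrable for \<alpha> > 0, with antiderivative a multiple of
  \<open>u powr \<alpha>\<close>. The cut at \<open>c\<close> is there because the kernel is not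
  integrable at infinity.\<close>

lemma integrable_rl_kernel:
  assumes "\<alpha> > 0"
  shows "integrable lborel (\<lambda>u. rl_kernel \<alpha> u * indicator {..c} u)"
proof (cases "c \<ge> 0")
  case True
  have "((\<lambda>u. u powr (\<alpha> - 1)) has_integral c powr (\<alpha> - 1 + 1) / (\<alpha> - 1 + 1)) {0..c}"
    using assms True by (intro has_integral_powr_from_0) auto
  hence "((\<lambda>u. u powr (\<alpha> - 1) / Gamma \<alpha>) has_integral c powr (\<alpha> - 1 + 1) / (\<alpha> - 1 + 1) / Gamma \<alpha>) {0..c}"
    by (rule has_integral_divide)
  hence "((\<lambda>u. rl_kernel \<alpha> u * indicator {..c} u) has_integral
      c powr (\<alpha> - 1 + 1) / (\<alpha> - 1 + 1) / Gamma \<alpha>) {0..c}"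
    by (rule has_integral_spike [OF negligible_sing [of 0], rotated]) (auto simp: rl_kernel_def)
  hence "((\<lambda>u. rl_kernel \<alpha> u * indicator {..c} u) has_integral
      c powr (\<alpha> - 1 + 1) / (\<alpha> - 1 + 1) / Gamma \<alpha>) UNIV"
    by (rule has_integral_on_superset) (auto simp: rl_kernel_def)
  thus ?thesis
    by (intro integrableI_nonneg)
       (auto simp: rl_kernel_nonneg assms nn_integral_has_integral_lborel)
next
  case False
  hence "(\<lambda>u. rl_kernel \<alpha> u * indicator {..c} u) = (\<lambda>_. 0)"
    by (auto simp: rl_kernel_def fun_eq_iff indicator_def)
  thus ?thesis by simp
qed

text \<open>The substitution s = t + c w with c = x - t produces the Beta integral, whose Gamma
  factors cancel those of the two kernels. Working with the nonnegative integral yields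
  integrability and value together.\<close>

lemma has_bochner_integral_rl_kernel_conv:
  assumes "\<alpha> > 0" "\<beta> > 0"
  shows "has_bochner_integral lborel (\<lambda>s. rl_kernel \<alpha> (x - s) * rl_kernel \<beta> (s - t))
           (rl_kernel (\<alpha> + \<beta>) (x - t))"
proof (rule has_bochner_integral_nn_integral)
  show "AE s in lborel. 0 \<le> rl_kernel \<alpha> (x - s) * rl_kernel \<beta> (s - t)"
    using assms by (auto simp: rl_kernel_nonneg)
  show "0 \<le> rl_kernel (\<alpha> + \<beta>) (x - t)"
    using assms by (auto simp: rl_kernel_nonneg)
  show "(\<integral>\<^sup>+ s. ennreal (rl_kernel \<alpha> (x - s) * rl_kernel \<beta> (s - t)) \<partial>lborel)
          = ennreal (rl_kernel (\<alpha> + \<beta>) (x - t))"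
  proof (cases "t < x")
    case False
    hence "(\<lambda>s. ennreal (rl_kernel \<alpha> (x - s) * rl_kernel \<beta> (s - t))) = (\<lambda>_. 0)"
      by (auto simp: rl_kernel_def fun_eq_iff)
    thus ?thesis using False by (simp add: rl_kernel_def)
  next
    case True
    define c where "c = x - t"
    have c: "c > 0" using True by (simp add: c_def)
    \<comment> \<open>The powers of \<open>c\<close> and the Gamma factors pulled out of the
      kernels; one further factor \<open>c\<close> comes from the change of variable.\<close>
    define K where "K = c powr (\<alpha> - 1) * c powr (\<beta> - 1) / (Gamma \<alpha> * Gamma \<beta>)"
    have K: "K \<ge> 0" using assms by (auto simp: K_def intro!: divide_nonneg_nonneg mult_nonneg_nonneg Gamma_real_nonneg)
    have "((\<lambda>w. K * (w powr (\<beta> - 1) * (1 - w) powr (\<alpha> - 1))) has_integral K * Beta \<beta> \<alpha>) {0..1}"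
      using assms by (intro has_integral_mult_right has_integral_Beta_real)
    hence "((\<lambda>w. rl_kernel \<alpha> (x - (t + c * w)) * rl_kernel \<beta> (t + c * w - t)) has_integral K * Beta \<beta> \<alpha>) {0..1}"
    proof (rule has_integral_spike [of "{0,1}", rotated 2])
      fix w :: real assume w: "w \<in> {0..1} - {0, 1}"
      have *: "x - (t + c * w) = c * (1 - w)" by (simp add: c_def algebra_simps)
      show "rl_kernel \<alpha> (x - (t + c * w)) * rl_kernel \<beta> (t + c * w - t)
              = K * (w powr (\<beta> - 1) * (1 - w) powr (\<alpha> - 1))"
        unfolding * using w c by (simp add: rl_kernel_def powr_mult K_def)
    qed auto
    hence "((\<lambda>w. rl_kernel \<alpha> (x - (t + c * w)) * rl_kernel \<beta> (t + c * w - t)) has_integral K * Beta \<beta> \<alpha>) UNIV"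
    proof (rule has_integral_on_superset)
      fix w :: real assume "w \<notin> {0..1}"
      hence "w < 0 \<or> 1 < w" by auto
      hence "c * w \<le> 0 \<or> c * 1 \<le> c * w"
        using c by (auto simp: mult_le_0_iff)
      hence "c * w \<le> 0 \<or> x - (t + c * w) \<le> 0" by (auto simp: c_def)
      thus "rl_kernel \<alpha> (x - (t + c * w)) * rl_kernel \<beta> (t + c * w - t) = 0"
        by (auto simp: rl_kernel_def)
    qed auto
    hence "(\<integral>\<^sup>+ w. ennreal (rl_kernel \<alpha> (x - (t + c * w)) * rl_kernel \<beta> (t + c * w - t)) \<partial>lborel) = ennreal (K * Beta \<beta> \<alpha>)"
      using assms by (intro nn_integral_has_integral_lborel) (auto simp: rl_kernel_nonneg)
    moreover have "(\<integral>\<^sup>+ s. ennreal (rl_kernel \<alpha> (x - s) * rl_kernel \<beta> (s - t)) \<partial>lborel)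
      = ennreal \<bar>c\<bar> * (\<integral>\<^sup>+ w. ennreal (rl_kernel \<alpha> (x - (t + c * w)) * rl_kernel \<beta> (t + c * w - t)) \<partial>lborel)"
      using c by (intro nn_integral_real_affine) auto
    ultimately have "(\<integral>\<^sup>+ s. ennreal (rl_kernel \<alpha> (x - s) * rl_kernel \<beta> (s - t)) \<partial>lborel) = ennreal (c * (K * Beta \<beta> \<alpha>))"
      using c by (simp add: ennreal_mult' )
    also have "c * (K * Beta \<beta> \<alpha>) = rl_kernel (\<alpha> + \<beta>) (x - t)"
    proof -
      have "c powr (\<alpha> + \<beta> - 1) = c * (c powr (\<alpha> - 1) * c powr (\<beta> - 1))"
        using c by (simp add: powr_add powr_diff)
      moreover have "Gamma \<alpha> > 0" "Gamma \<beta> > 0"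
        using assms by (auto intro: Gamma_real_pos)
      ultimately show ?thesis
        using c unfolding c_def [symmetric] by (simp add: rl_kernel_def K_def Beta_def add.commute)
    qed
    finally show ?thesis .
  qed
qed auto

text \<open>The kernel vanishes for u \<le> 0 and so cuts the integral at t = x; the lower end sits
  in the indicator. With no variable bounds left, Fubini can be applied on the whole plane instead
  of a triangle.\<close>

lemma RL_integral_eq_conv:
  assumes "\<alpha> > 0"
  shows "RL_integral a \<alpha> f x = (\<integral>t. rl_kernel \<alpha> (x - t) * (indicator {a..} t * f t) \<partial>lborel)"
proof -
  have "RL_integral a \<alpha> f x =
      (\<integral>t. 1 / Gamma \<alpha> * (indicator {a..x} t * ((x - t) powr (\<alpha> - 1) * f t)) \<partial>lborel)"
    using assms by (simp add: RL_integral_def set_lebesgue_integral_def)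
  also have "\<dots> = (\<integral>t. rl_kernel \<alpha> (x - t) * (indicator {a..} t * f t) \<partial>lborel)"
    by (intro Bochner_Integration.integral_cong) (auto simp: rl_kernel_def indicator_def)
  finally show ?thesis .
qed

text \<open>Where \<open>G\<close> can be nonzero, x - t is at most x - a, so the reflected kernel
  cut at x - a, times \<open>M\<close>, dominates.\<close>

lemma integrable_rl_kernel_mult:
  assumes "\<alpha> > 0" and [measurable]: "G \<in> borel_measurable borel"
    and bound: "\<And>t. \<bar>G t\<bar> \<le> M" and zero: "\<And>t. t < a \<Longrightarrow> G t = 0"
  shows "integrable lborel (\<lambda>t. rl_kernel \<alpha> (x - t) * G t)"
proof -
  have "integrable lborel (\<lambda>t. rl_kernel \<alpha> (x + (-1) * t) * indicator {..x-a} (x + (-1) * t))"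
    using integrable_rl_kernel [OF assms(1)] by (rule lborel_integrable_real_affine) auto
  hence "integrable lborel (\<lambda>t. M * (rl_kernel \<alpha> (x - t) * indicator {..x-a} (x - t)))"
    by simp
  thus ?thesis
  proof (rule Bochner_Integration.integrable_bound)
    have "\<bar>rl_kernel \<alpha> (x - t) * G t\<bar> \<le> \<bar>M * (rl_kernel \<alpha> (x - t) * indicator {..x-a} (x - t))\<bar>" for t
    proof (cases "t < a")
      case False
      have "\<bar>G t\<bar> * rl_kernel \<alpha> (x - t) \<le> \<bar>M\<bar> * rl_kernel \<alpha> (x - t)"
        using bound [of t] rl_kernel_nonneg [OF assms(1)] by (intro mult_right_mono) auto
      thus ?thesis
        using False rl_kernel_nonneg [OF assms(1), of "x - t"] by (simp add: abs_mult mult.commute)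
    qed (simp add: zero)
    thus "AE t in lborel. norm (rl_kernel \<alpha> (x - t) * G t)
        \<le> norm (M * (rl_kernel \<alpha> (x - t) * indicator {..x-a} (x - t)))"
      by simp
  qed auto
qed

text \<open>After exchanging the integrals, the inner one is the convolution of two kernels. As the
  kernels are nonnegative, the same computation with \<bar>G t\<bar> supplies the absolute
  integrability that the exchange requires.\<close>

lemma rl_kernel_semigroup:
  assumes \<alpha>: "\<alpha> > 0" and \<beta>: "\<beta> > 0" and [measurable]: "G \<in> borel_measurable borel"
    and bound: "\<And>t. \<bar>G t\<bar> \<le> M" and zero: "\<And>t. t < a \<Longrightarrow> G t = 0"
  shows "(\<integral>s. rl_kernel \<alpha> (x - s) * (\<integral>t. rl_kernel \<beta> (s - t) * G t \<partial>lborel) \<partial>lborel)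
           = (\<integral>t. rl_kernel (\<alpha> + \<beta>) (x - t) * G t \<partial>lborel)"
proof -
  define F where "F t s = rl_kernel \<alpha> (x - s) * rl_kernel \<beta> (s - t) * G t" for t s
  have I: "has_bochner_integral lborel (F t) (rl_kernel (\<alpha> + \<beta>) (x - t) * G t)" for t
    unfolding F_def [abs_def]
    using has_bochner_integral_rl_kernel_conv [OF \<alpha> \<beta>] by (rule has_bochner_integral_mult_left)
  have "norm (F t s) = rl_kernel \<alpha> (x - s) * rl_kernel \<beta> (s - t) * \<bar>G t\<bar>" for t s
    by (simp add: F_def abs_mult rl_kernel_nonneg \<alpha> \<beta>)
  hence "has_bochner_integral lborel (\<lambda>s. norm (F t s)) (rl_kernel (\<alpha> + \<beta>) (x - t) * \<bar>G t\<bar>)" for t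
    using has_bochner_integral_rl_kernel_conv [OF \<alpha> \<beta>]
    by (simp only:) (rule has_bochner_integral_mult_left)
  hence norm: "(\<integral>s. norm (F t s) \<partial>lborel) = rl_kernel (\<alpha> + \<beta>) (x - t) * \<bar>G t\<bar>" for t
    by (rule has_bochner_integral_integral_eq)
  have "integrable (lborel \<Otimes>\<^sub>M lborel) (case_prod F)"
  proof (rule lborel_pair.Fubini_integrable)
    show "case_prod F \<in> borel_measurable (lborel \<Otimes>\<^sub>M lborel)"
      unfolding F_def case_prod_unfold by measurable
    show "integrable lborel (\<lambda>t. \<integral>s. norm (case_prod F (t, s)) \<partial>lborel)"
      unfolding prod.case norm using \<alpha> \<beta> bound zero
      by (intro integrable_rl_kernel_mult [where M = M and a = a]) auto
    show "AE t in lborel. integrable lborel (\<lambda>s. case_prod F (t, s))"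
      using I by (auto simp: has_bochner_integral_iff)
  qed
  hence "(\<integral>s. (\<integral>t. F t s \<partial>lborel) \<partial>lborel) = (\<integral>t. (\<integral>s. F t s \<partial>lborel) \<partial>lborel)"
    by (rule lborel_pair.Fubini_integral)
  thus ?thesis
    unfolding has_bochner_integral_integral_eq [OF I] by (simp add: F_def mult.assoc)
qed

text \<open>Extending a continuous function constantly beyond \<open>{a..b}\<close> makes it bounded and Borel
  measurable without changing its fractional integrals on \<open>{a..b}\<close>.\<close>

lemma continuous_bounded_extension:
  fixes f :: "real \<Rightarrow> real"
  assumes "a < b" "continuous_on {a..b} f"
  obtains g M where "continuous_on UNIV g" "\<And>t. \<bar>g t\<bar> \<le> M" "\<And>t. t \<in> {a..b} \<Longrightarrow> g t = f t"
proof -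
  have cont: "continuous_on UNIV (\<lambda>t. f (max a (min b t)))"
    using assms by (intro continuous_on_compose2 [OF assms(2)] continuous_intros) auto
  have "bounded (f ` {a..b})"
    by (intro compact_imp_bounded compact_continuous_image assms compact_Icc)
  then obtain M where M: "\<And>y. y \<in> f ` {a..b} \<Longrightarrow> norm y \<le> M"
    unfolding bounded_iff by blast
  show ?thesis
  proof
    show "\<bar>f (max a (min b t))\<bar> \<le> M" for t
      using M [of "f (max a (min b t))"] assms(1) by simp
    show "f (max a (min b t)) = f t" if "t \<in> {a..b}" for t
      using that by simp
  qed (rule cont)
qed

lemma RL_integral_cong:
  assumes "\<And>t. t \<in> {a..x} \<Longrightarrow> f t = g t" "a \<le> x"
  shows "RL_integral a \<alpha> f x = RL_integral a \<alpha> g x"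
  using assms unfolding RL_integral_def
  by (auto intro!: set_lebesgue_integral_cong)

lemma RL_integral_0 [simp]: "RL_integral a 0 f = f"
  by (simp add: RL_integral_def fun_eq_iff)

lemma RL_integral_at_start:
  assumes "\<alpha> > 0"
  shows "RL_integral a \<alpha> f a = 0"
proof -
  have "(\<lambda>t. rl_kernel \<alpha> (a - t) * (indicator {a..} t * f t)) = (\<lambda>_. 0)"
    by (auto simp: rl_kernel_def fun_eq_iff)
  thus ?thesis using assms by (simp add: RL_integral_eq_conv)
qed

lemma RL_integral_cmult:
  assumes "\<alpha> \<ge> 0"
  shows "RL_integral a \<alpha> (\<lambda>t. c * f t) x = c * RL_integral a \<alpha> f x"
proof (cases "\<alpha> = 0")
  case False
  with assms show ?thesis
    by (simp add: RL_integral_eq_conv mult.left_commute [of _ c])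
qed auto

subsection \<open>Fractional integrals of continuous functions\<close>

context
  fixes a b :: real
  assumes ab: "a < b"
begin

lemma integrable_RL_integrand:
  assumes f: "continuous_on {a..b} f" and "\<alpha> > 0" "x \<in> {a..b}"
  shows "integrable lborel (\<lambda>t. rl_kernel \<alpha> (x - t) * (indicator {a..} t * f t))"
proof -
  obtain g M where g: "continuous_on UNIV g" "\<And>t. \<bar>g t\<bar> \<le> M" "\<And>t. t \<in> {a..b} \<Longrightarrow> g t = f t"
    using continuous_bounded_extension [OF ab f] by blast
  have [measurable]: "g \<in> borel_measurable borel"
    using g(1) by (rule borel_measurable_continuous_onI)
  have "M \<ge> 0" using g(2)[of 0] by linarith
  hence "\<bar>indicator {a..} t * g t\<bar> \<le> M" for t
    using g(2) [of t] by (simp add: indicator_def)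
  hence "integrable lborel (\<lambda>t. rl_kernel \<alpha> (x - t) * (indicator {a..} t * g t))"
    by (intro integrable_rl_kernel_mult [OF \<open>\<alpha> > 0\<close>, where M = M and a = a]) simp_all
  also have "(\<lambda>t. rl_kernel \<alpha> (x - t) * (indicator {a..} t * g t)) =
      (\<lambda>t. rl_kernel \<alpha> (x - t) * (indicator {a..} t * f t))"
  proof
    fix t
    show "rl_kernel \<alpha> (x - t) * (indicator {a..} t * g t) = rl_kernel \<alpha> (x - t) * (indicator {a..} t * f t)"
      using \<open>x \<in> {a..b}\<close> g(3) [of t] by (cases "t \<in> {a..b}") (auto simp: rl_kernel_def)
  qed
  finally show ?thesis .
qed

lemma RL_integral_add:
  assumes "continuous_on {a..b} f" "continuous_on {a..b} g" "\<alpha> \<ge> 0" "x \<in> {a..b}"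
  shows "RL_integral a \<alpha> (\<lambda>t. f t + g t) x = RL_integral a \<alpha> f x + RL_integral a \<alpha> g x"
proof (cases "\<alpha> = 0")
  case False
  with assms show ?thesis
    by (simp add: RL_integral_eq_conv distrib_left integrable_RL_integrand)
qed auto

text \<open>Substituting t = x - (x - a) w fixes both the domain and the singularity, now at w = 0,
  and splits off the factor \<open>(x - a) powr \<alpha>\<close>. In what remains, \<open>x\<close>
  occurs only inside the bounded continuous \<open>g\<close>, so dominated convergence
  applies.\<close>

lemma continuous_on_RL_integral:
  assumes f: "continuous_on {a..b} f" and "\<alpha> \<ge> 0"
  shows "continuous_on {a..b} (RL_integral a \<alpha> f)"
proof (cases "\<alpha> = 0")
  case False
  hence \<alpha>: "\<alpha> > 0" using assms by simp
  obtain g M where g: "continuous_on UNIV g" "\<And>t. \<bar>g t\<bar> \<le> M" "\<And>t. t \<in> {a..b} \<Longrightarrow> g t = f t"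
    using continuous_bounded_extension [OF ab f] by blast
  have [measurable]: "g \<in> borel_measurable borel"
    using g(1) by (rule borel_measurable_continuous_onI)
  define H where "H x = (\<integral>w. rl_kernel \<alpha> w * indicator {..1} w * g (x - (x - a) * w) \<partial>lborel)" for x
  have eq: "RL_integral a \<alpha> f x = (x - a) powr \<alpha> * H x" if x: "x \<in> {a..b}" for x
  \<comment> \<open>The substitution degenerates at x = a; there both sides vanish, since
    \<open>0 powr \<alpha> = 0\<close>.\<close>
  proof (cases "x = a")
    case True thus ?thesis using \<alpha> by (simp add: RL_integral_at_start)
  next
    case False
    hence xa: "x - a > 0" using x by auto
    have "RL_integral a \<alpha> f x = RL_integral a \<alpha> g x"
      using x g(3) by - (rule RL_integral_cong, auto)
    also have "\<dots> = (\<integral>t. rl_kernel \<alpha> (x - t) * (indicator {a..} t * g t) \<partial>lborel)"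
      using \<alpha> by (rule RL_integral_eq_conv)
    also have "\<dots> = \<bar>-(x - a)\<bar> *\<^sub>R (\<integral>w. rl_kernel \<alpha> (x - (x + -(x - a) * w)) *
        (indicator {a..} (x + -(x - a) * w) * g (x + -(x - a) * w)) \<partial>lborel)"
      using xa by (intro lborel_integral_real_affine) auto
    also have "(\<lambda>w. rl_kernel \<alpha> (x - (x + -(x - a) * w)) *
        (indicator {a..} (x + -(x - a) * w) * g (x + -(x - a) * w))) =
        (\<lambda>w. (x - a) powr (\<alpha> - 1) * (rl_kernel \<alpha> w * indicator {..1} w * g (x - (x - a) * w)))"
    proof
      fix w
      have "a \<le> x + -(x - a) * w \<longleftrightarrow> (x - a) * w \<le> (x - a) * 1" by (auto simp: algebra_simps)
      also have "\<dots> \<longleftrightarrow> w \<le> 1" using xa by (subst mult_le_cancel_left_pos) auto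
      finally have 1: "indicator {a..} (x + -(x - a) * w) = (indicator {..1} w :: real)"
        by (simp add: indicator_def)
      have 2: "rl_kernel \<alpha> (x - (x + -(x - a) * w)) = (x - a) powr (\<alpha> - 1) * rl_kernel \<alpha> w"
      proof -
        have "x - (x + -(x - a) * w) = (x - a) * w" by (simp add: algebra_simps)
        thus ?thesis using xa by (simp add: rl_kernel_def powr_mult zero_less_mult_iff)
      qed
      show "rl_kernel \<alpha> (x - (x + -(x - a) * w)) *
        (indicator {a..} (x + -(x - a) * w) * g (x + -(x - a) * w)) =
         (x - a) powr (\<alpha> - 1) * (rl_kernel \<alpha> w * indicator {..1} w * g (x - (x - a) * w))"
        unfolding 1 2 by (simp add: algebra_simps)
    qed
    finally show ?thesis using xa by (simp add: H_def powr_diff)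
  qed
  have "continuous_on {a..b} H"
  proof (unfold continuous_on_sequentially comp_def, safe)
    fix u :: "nat \<Rightarrow> real" and x assume x: "x \<in> {a..b}" and u: "\<forall>n. u n \<in> {a..b}" "u \<longlonglongrightarrow> x"
    show "(\<lambda>n. H (u n)) \<longlonglongrightarrow> H x"
      unfolding H_def
    proof (rule integral_dominated_convergence [where w = "\<lambda>w. M * (rl_kernel \<alpha> w * indicator {..1} w)"])
      show "integrable lborel (\<lambda>w. M * (rl_kernel \<alpha> w * indicator {..1} w))"
        using integrable_rl_kernel [OF \<alpha>] by simp
      show "AE w in lborel. norm (rl_kernel \<alpha> w * indicator {..1} w * g (u n - (u n - a) * w))
              \<le> M * (rl_kernel \<alpha> w * indicator {..1} w)" for n
        using g(2) rl_kernel_nonneg [OF \<alpha>]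
        by (auto simp: abs_mult indicator_def mult.commute [of M] intro!: mult_left_mono)
      show "AE w in lborel. (\<lambda>n. rl_kernel \<alpha> w * indicator {..1} w * g (u n - (u n - a) * w))
          \<longlonglongrightarrow> rl_kernel \<alpha> w * indicator {..1} w * g (x - (x - a) * w)"
        using u(2) by (intro AE_I2 tendsto_intros continuous_on_tendsto_compose [OF g(1)]) auto
    qed measurable
  qed
  hence "continuous_on {a..b} (\<lambda>x. (x - a) powr \<alpha> * H x)"
    using \<alpha> by (intro continuous_intros continuous_on_powr') auto
  thus ?thesis by (rule continuous_on_eq) (simp only: eq)
qed (use f in auto)

lemma RL_integral_RL_integral:
  assumes f: "continuous_on {a..b} f" and "\<alpha> \<ge> 0" "\<beta> \<ge> 0" and x: "x \<in> {a..b}"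
  shows "RL_integral a \<alpha> (RL_integral a \<beta> f) x = RL_integral a (\<alpha> + \<beta>) f x"
proof (cases "\<alpha> = 0 \<or> \<beta> = 0")
  case False
  hence \<alpha>: "\<alpha> > 0" and \<beta>: "\<beta> > 0" using assms by auto
  obtain g M where g: "continuous_on UNIV g" "\<And>t. \<bar>g t\<bar> \<le> M" "\<And>t. t \<in> {a..b} \<Longrightarrow> g t = f t"
    using continuous_bounded_extension [OF ab f] by blast
  have [measurable]: "g \<in> borel_measurable borel"
    using g(1) by (rule borel_measurable_continuous_onI)
  have "M \<ge> 0" using g(2)[of 0] by linarith
  define G where "G t = indicator {a..} t * g t" for t
  have "RL_integral a \<alpha> (RL_integral a \<beta> f) x = RL_integral a \<alpha> (RL_integral a \<beta> g) x"
    using x g(3) by - (rule RL_integral_cong, rule RL_integral_cong, auto)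
  also have "\<dots> = (\<integral>s. rl_kernel \<alpha> (x - s) * (indicator {a..} s * (\<integral>t. rl_kernel \<beta> (s - t) * G t \<partial>lborel)) \<partial>lborel)"
    using \<alpha> \<beta> by (simp add: RL_integral_eq_conv G_def)
  also have "\<dots> = (\<integral>s. rl_kernel \<alpha> (x - s) * (\<integral>t. rl_kernel \<beta> (s - t) * G t \<partial>lborel) \<partial>lborel)"
  proof (intro Bochner_Integration.integral_cong refl)
    fix s
    have "(\<lambda>t. rl_kernel \<beta> (s - t) * G t) = (\<lambda>_. 0)" if "s < a"
      using that by (auto simp: fun_eq_iff rl_kernel_def G_def indicator_def)
    thus "rl_kernel \<alpha> (x - s) * (indicator {a..} s * (\<integral>t. rl_kernel \<beta> (s - t) * G t \<partial>lborel))
        = rl_kernel \<alpha> (x - s) * (\<integral>t. rl_kernel \<beta> (s - t) * G t \<partial>lborel)"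
      by (cases "s < a") auto
  qed
  also have "\<dots> = (\<integral>t. rl_kernel (\<alpha> + \<beta>) (x - t) * G t \<partial>lborel)"
  proof (rule rl_kernel_semigroup [OF \<alpha> \<beta>, where M = M and a = a])
    show "G \<in> borel_measurable borel" unfolding G_def [abs_def] by measurable
    show "\<bar>G t\<bar> \<le> M" for t
      using g(2) [of t] \<open>M \<ge> 0\<close> by (simp add: G_def indicator_def)
  qed (simp add: G_def)
  also have "\<dots> = RL_integral a (\<alpha> + \<beta>) g x"
    using \<alpha> \<beta> by (simp add: RL_integral_eq_conv G_def)
  also have "\<dots> = RL_integral a (\<alpha> + \<beta>) f x"
    using x g(3) by - (rule RL_integral_cong, auto)
  finally show ?thesis .
qed auto

lemma RL_integral_1_has_vector_derivative:
  assumes f: "continuous_on {a..b} f" and x: "x \<in> {a..b}"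
  shows "(RL_integral a 1 f has_vector_derivative f x) (at x within {a..b})"
proof (rule has_vector_derivative_transform [OF x _ integral_has_vector_derivative [OF f x]])
  fix y assume y: "y \<in> {a..b}"
  hence f': "continuous_on {a..y} f" using f by (auto intro: continuous_on_subset)
  have "RL_integral a 1 f y = (LBINT t:{a..y}. (y - t) powr 0 * f t)"
    by (simp add: RL_integral_def)
  also have "\<dots> = (LBINT t:{a..y}. f t)"
    unfolding set_lebesgue_integral_def
  proof (rule integral_cong_AE)
    \<comment> \<open>The default \<open>0 powr 0 = 0\<close> can make the integrands differ at t =
      y, a null set.\<close>
    show "AE t in lborel. indicator {a..y} t *\<^sub>R ((y - t) powr 0 * f t) = indicator {a..y} t *\<^sub>R f t"
      using AE_lborel_singleton [of y] by eventually_elim auto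
    show *: "(\<lambda>t. indicator {a..y} t *\<^sub>R f t) \<in> borel_measurable lborel"
      using borel_measurable_continuous_on_indicator [OF _ f'] by simp
    \<comment> \<open>Regrouped so that \<open>f\<close> occurs only together with its indicator:
      nothing is known about measurability of \<open>f\<close> off the interval.\<close>
    have "(\<lambda>t. (y - t) powr 0 * (indicator {a..y} t *\<^sub>R f t)) \<in> borel_measurable lborel"
      using * by measurable
    thus "(\<lambda>t. indicator {a..y} t *\<^sub>R ((y - t) powr 0 * f t)) \<in> borel_measurable lborel"
      by (simp add: mult_ac)
  qed
  also have "\<dots> = integral {a..y} f"
    using borel_integrable_atLeastAtMost' [OF f'] by (rule set_borel_integral_eq_integral)
  finally show "RL_integral a 1 f y = integral {a..y} f" .
qed

lemma RL_integral_1_derivative: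
  assumes F: "\<And>x. x \<in> {a..b} \<Longrightarrow> (F has_vector_derivative f x) (at x within {a..b})"
    and f: "continuous_on {a..b} f" and x: "x \<in> {a..b}"
  shows "RL_integral a 1 f x = F x - F a"
proof -
  have "((\<lambda>y. RL_integral a 1 f y - F y) has_vector_derivative 0) (at y within {a..b})" if "y \<in> {a..b}" for y
    using has_vector_derivative_diff [OF RL_integral_1_has_vector_derivative [OF f that] F [OF that]] by simp
  then obtain c where "\<And>y. y \<in> {a..b} \<Longrightarrow> RL_integral a 1 f y - F y = c"
    using has_vector_derivative_zero_constant [OF convex_closed_interval(1), of a b "\<lambda>y. RL_integral a 1 f y - F y"] by auto
  from this [of a] this [of x] show ?thesis
    using x ab by (simp add: RL_integral_at_start)
qed

end

subsection \<open>Caputo differentiability as an integral equation\<close>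

lemma floor_ceiling_nat_order:
  fixes \<beta> :: real
  assumes "\<beta> > 0"
  shows "nat \<lceil>\<beta>\<rceil> \<ge> 1" "\<beta> \<le> real (nat \<lceil>\<beta>\<rceil>)" "real (nat \<lceil>\<beta>\<rceil>) - 1 < \<beta>"
  using assms by linarith+

text \<open>The hypothesis means that \<beta> + \<gamma> does not exceed the next integer after
  \<beta>. The Taylor polynomials belonging to the two orders thus have equal length for fractional
  \<beta> and differ by one term for natural \<beta>.\<close>

lemma nat_ceiling_sum:
  fixes \<beta> \<gamma> :: real
  assumes "\<beta> > 0" "0 < \<gamma>" "\<lceil>\<beta> + \<gamma>\<rceil> - \<lfloor>\<beta>\<rfloor> = 1"
  shows "\<beta> \<notin> \<nat> \<Longrightarrow> nat \<lceil>\<beta> + \<gamma>\<rceil> = nat \<lceil>\<beta>\<rceil>"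
    and "\<beta> \<in> \<nat> \<Longrightarrow> nat \<lceil>\<beta> + \<gamma>\<rceil> = Suc (nat \<lceil>\<beta>\<rceil>)"
    and "\<beta> \<in> \<nat> \<Longrightarrow> real (nat \<lceil>\<beta>\<rceil>) = \<beta>"
proof -
  show "nat \<lceil>\<beta> + \<gamma>\<rceil> = nat \<lceil>\<beta>\<rceil>" if "\<beta> \<notin> \<nat>"
  proof -
    have "\<beta> \<notin> \<int>" using that assms(1) by (auto simp: Nats_altdef2)
    hence "\<beta> \<noteq> of_int \<lfloor>\<beta>\<rfloor>" by (rule contrapos_nn) (erule ssubst, rule Ints_of_int)
    hence "\<lceil>\<beta>\<rceil> = \<lfloor>\<beta>\<rfloor> + 1" by (simp add: ceiling_altdef)
    thus ?thesis using assms by simp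
  qed
  show "nat \<lceil>\<beta> + \<gamma>\<rceil> = Suc (nat \<lceil>\<beta>\<rceil>)" "real (nat \<lceil>\<beta>\<rceil>) = \<beta>" if nat: "\<beta> \<in> \<nat>"
  proof -
    obtain j where j: "\<beta> = real j" using nat by (rule Nats_cases)
    have "\<lceil>\<beta>\<rceil> = int j" "\<lfloor>\<beta>\<rfloor> = int j" by (simp_all add: j)
    thus "nat \<lceil>\<beta> + \<gamma>\<rceil> = Suc (nat \<lceil>\<beta>\<rceil>)" "real (nat \<lceil>\<beta>\<rceil>) = \<beta>"
      using assms(3) j by simp_all
  qed
qed

context
  fixes a b :: real
  assumes ab: "a < b"
begin

section \<open>Iterated derivatives within the interval\<close>

lemma nth_deriv_has_vector_derivative:
  assumes "times_differentiable a b n f" "k < n" "x \<in> {a..b}"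
  shows "(nth_deriv a b k f has_vector_derivative nth_deriv a b (Suc k) f x) (at x within {a..b})"
  using assms by (simp add: times_differentiable_def vector_derivative_works)

text \<open>Derivatives within \<open>{a..b}\<close> see only the values there and are unique
  because a < b, so a chain of successive derivatives determines \<open>nth_deriv\<close> by
  induction.\<close>

lemma
  assumes f: "\<And>x. x \<in> {a..b} \<Longrightarrow> g 0 x = f x"
    and deriv: "\<And>k x. k < n \<Longrightarrow> x \<in> {a..b} \<Longrightarrow> (g k has_vector_derivative g (Suc k) x) (at x within {a..b})"
  shows nth_deriv_eqI: "\<And>k x. k \<le> n \<Longrightarrow> x \<in> {a..b} \<Longrightarrow> nth_deriv a b k f x = g k x"
    and times_differentiableI: "times_differentiable a b n f"
proof -
  have eq: "k \<le> n \<Longrightarrow> \<forall>x\<in>{a..b}. nth_deriv a b k f x = g k x" for k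
  proof (induction k)
    case 0 thus ?case using f by simp
  next
    case (Suc k)
    have "(nth_deriv a b k f has_vector_derivative g (Suc k) x) (at x within {a..b})" if "x \<in> {a..b}" for x
      using Suc that by (intro has_vector_derivative_transform [OF that _ deriv]) auto
    hence "nth_deriv a b (Suc k) f x = g (Suc k) x" if "x \<in> {a..b}" for x
      unfolding nth_deriv.simps using that by (intro vector_derivative_within_closed_interval [OF ab])
    thus ?case by simp
  qed
  show "nth_deriv a b k f x = g k x" if "k \<le> n" "x \<in> {a..b}" for k x
    using eq [OF that(1)] that(2) by (rule bspec)
  have "(nth_deriv a b k f has_vector_derivative g (Suc k) x) (at x within {a..b})"
    if "k < n" "x \<in> {a..b}" for k x
    using eq [of k] that by (intro has_vector_derivative_transform [OF that(2) _ deriv]) auto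
  thus "times_differentiable a b n f"
    unfolding times_differentiable_def by (blast intro: differentiableI_vector)
qed

lemma C_class_continuous_on:
  assumes "C_class a b n f" "k \<le> n"
  shows "continuous_on {a..b} (nth_deriv a b k f)"
proof (cases "k = n")
  case False
  with assms show ?thesis
    unfolding C_class_def times_differentiable_def
    by (auto simp: continuous_on_eq_continuous_within intro!: differentiable_imp_continuous_within)
qed (use assms in \<open>auto simp: C_class_def\<close>)

lemma C_class_mono: "C_class a b n f \<Longrightarrow> k \<le> n \<Longrightarrow> C_class a b k f"
  using C_class_continuous_on by (auto simp: C_class_def times_differentiable_def)

lemma RL_integral_Suc_has_vector_derivative:
  assumes f: "continuous_on {a..b} f" and "\<alpha> \<ge> 0" and x: "x \<in> {a..b}"
  shows "(RL_integral a (\<alpha> + 1) f has_vector_derivative RL_integral a \<alpha> f x) (at x within {a..b})"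
  using assms
  by (intro has_vector_derivative_transform [OF x _ RL_integral_1_has_vector_derivative [OF ab _ x]]
        continuous_on_RL_integral [OF ab])
     (auto simp: RL_integral_RL_integral [OF ab] add.commute)

section \<open>Integer orders: Taylor's formula and its converse\<close>

text \<open>The semigroup law raises the order one by one, so only ordinary antiderivatives occur
  and no Gamma value has to be computed.\<close>

lemma RL_integral_monomial:
  "x \<in> {a..b} \<Longrightarrow> RL_integral a (real n) (\<lambda>_. 1) x = (x - a) ^ n / fact n"
proof (induction n arbitrary: x)
  case (Suc n)
  have "RL_integral a (real (Suc n)) (\<lambda>_. 1) x = RL_integral a (1 + real n) (\<lambda>_. 1) x"
    by simp
  also have "\<dots> = RL_integral a 1 (RL_integral a (real n) (\<lambda>_. 1)) x"
    by (rule RL_integral_RL_integral [OF ab continuous_on_const _ _ Suc.prems, symmetric]) simp_all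
  also have "\<dots> = RL_integral a 1 (\<lambda>x. (x - a) ^ n / fact n) x"
    using Suc by - (rule RL_integral_cong, auto)
  also have "\<dots> = (x - a) ^ Suc n / fact (Suc n) - (a - a) ^ Suc n / fact (Suc n)"
  proof (rule RL_integral_1_derivative [OF ab _ _ Suc.prems])
    fix y
    have "((\<lambda>x. (x - a) ^ Suc n / fact (Suc n)) has_real_derivative
        (1 + real n) * ((1 - 0) * (y - a) ^ n) / fact (Suc n)) (at y within {a..b})"
      by (intro DERIV_cdivide DERIV_power_Suc DERIV_diff DERIV_ident DERIV_const)
    also have "(1 + real n) * ((1 - 0) * (y - a) ^ n) / fact (Suc n) = (y - a) ^ n / fact n"
    proof -
      have "fact (Suc n) = (1 + real n) * fact n" "1 + real n \<noteq> 0" by simp_all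
      thus ?thesis by (simp only:) simp
    qed
    finally show "((\<lambda>x. (x - a) ^ Suc n / fact (Suc n)) has_vector_derivative
        (y - a) ^ n / fact n) (at y within {a..b})"
      by (simp add: has_real_derivative_iff_has_vector_derivative)
  qed (intro continuous_intros, simp)
  finally show ?case by simp
qed auto

text \<open>Applying \<open>J^n\<close> to \<open>D^n f = D^n f(a) + J^1 (D^(n+1) f)\<close> splits
  off the monomial of degree n.\<close>

lemma Taylor_RL_integral:
  assumes "C_class a b n f" "x \<in> {a..b}"
  shows "f x = (\<Sum>k<n. nth_deriv a b k f a / fact k * (x - a) ^ k)
                 + RL_integral a (real n) (nth_deriv a b n f) x"
  using assms(1)
proof (induction n)
  case (Suc n)
  let ?D = "nth_deriv a b"
  have cont: "continuous_on {a..b} (?D (Suc n) f)" and td: "times_differentiable a b (Suc n) f"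
    using Suc.prems by (auto simp: C_class_def)
  \<comment> \<open>The constant is written as a multiple of 1 so that
    \<open>RL_integral_cmult\<close> and \<open>RL_integral_monomial\<close> match.\<close>
  have D: "?D n f t = ?D n f a * 1 + RL_integral a 1 (?D (Suc n) f) t" if "t \<in> {a..b}" for t
    using RL_integral_1_derivative [OF ab nth_deriv_has_vector_derivative [OF td] cont that] by simp
  have "RL_integral a (real n) (?D n f) x =
      RL_integral a (real n) (\<lambda>t. ?D n f a * 1 + RL_integral a 1 (?D (Suc n) f) t) x"
    by (rule RL_integral_cong, rule D) (use assms(2) in auto)
  also have "\<dots> = RL_integral a (real n) (\<lambda>t. ?D n f a * 1) x
      + RL_integral a (real n) (RL_integral a 1 (?D (Suc n) f)) x"
    using assms(2) cont by (intro RL_integral_add [OF ab] continuous_on_RL_integral [OF ab]) auto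
  also have "\<dots> = ?D n f a * ((x - a) ^ n / fact n) + RL_integral a (real n + 1) (?D (Suc n) f) x"
    using assms(2) cont by (simp only: RL_integral_cmult of_nat_0_le_iff RL_integral_monomial
        RL_integral_RL_integral [OF ab cont] zero_le_one)
  finally show ?case
    using Suc.IH [OF C_class_mono [OF Suc.prems]] by (simp add: add.commute)
qed auto

text \<open>The converse of \<open>Taylor_RL_integral\<close>, with arbitrary coefficients. Taking
  all of them 0 shows that n-fold differentiation inverts \<open>J^n\<close>.\<close>

lemma
  assumes w: "continuous_on {a..b} w"
    and f: "\<And>x. x \<in> {a..b} \<Longrightarrow> f x = (\<Sum>k<n. c k / fact k * (x - a) ^ k) + RL_integral a (real n) w x"
  shows C_class_RL_integralI: "C_class a b n f"
    and nth_deriv_RL_integral: "\<And>x. x \<in> {a..b} \<Longrightarrow> nth_deriv a b n f x = w x"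
proof -
  \<comment> \<open>The candidate for the j-th derivative: the terms below degree j have died. At j
    = n the sum is empty and \<open>J^0 w = w\<close> remains.\<close>
  define g where
    "g j x = (\<Sum>k=j..<n. c k / fact (k - j) * (x - a) ^ (k - j)) + RL_integral a (real (n - j)) w x" for j x
  have deriv: "(g j has_vector_derivative g (Suc j) x) (at x within {a..b})"
    if "j < n" "x \<in> {a..b}" for j x
  proof -
    have "((\<lambda>x. \<Sum>k=j..<n. c k / fact (k - j) * (x - a) ^ (k - j)) has_real_derivative
        (\<Sum>k=j..<n. c k / fact (k - j) * (real (k - j) * (x - a) ^ (k - j - 1)))) (at x within {a..b})"
      by (auto intro!: derivative_eq_intros sum.cong)
    also have "(\<Sum>k=j..<n. c k / fact (k - j) * (real (k - j) * (x - a) ^ (k - j - 1)))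
        = (\<Sum>k=Suc j..<n. c k / fact (k - Suc j) * (x - a) ^ (k - Suc j))"
    \<comment> \<open>The term k = j is constant; its factor \<open>real (k - j)\<close> is
      0.\<close>
    proof (rule sum.mono_neutral_cong_right)
      fix k assume "k \<in> {Suc j..<n}"
      then obtain i where "k = Suc (j + i)" using less_imp_Suc_add [of j k] by auto
      thus "c k / fact (k - j) * (real (k - j) * (x - a) ^ (k - j - 1))
          = c k / fact (k - Suc j) * (x - a) ^ (k - Suc j)"
        by (simp del: of_nat_Suc)
    qed auto
    finally have 1: "((\<lambda>x. \<Sum>k=j..<n. c k / fact (k - j) * (x - a) ^ (k - j)) has_vector_derivative
        (\<Sum>k=Suc j..<n. c k / fact (k - Suc j) * (x - a) ^ (k - Suc j))) (at x within {a..b})"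
      by (simp add: has_real_derivative_iff_has_vector_derivative)
    have "real (n - j) = real (n - Suc j) + 1" using that by simp
    hence "(RL_integral a (real (n - j)) w has_vector_derivative RL_integral a (real (n - Suc j)) w x)
        (at x within {a..b})"
      using RL_integral_Suc_has_vector_derivative [OF w _ that(2), of "real (n - Suc j)"] by simp
    from has_vector_derivative_add [OF 1 this] show ?thesis
      unfolding g_def .
  qed
  have g0: "g 0 x = f x" if "x \<in> {a..b}" for x
    using f [OF that] by (simp add: g_def atLeast0LessThan)
  show nd: "nth_deriv a b n f x = w x" if "x \<in> {a..b}" for x
    using nth_deriv_eqI [of g f n n x, OF g0 deriv] that by (simp add: g_def)
  have "times_differentiable a b n f"
    by (rule times_differentiableI [of g, OF g0 deriv])
  moreover have "continuous_on {a..b} (nth_deriv a b n f)"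
    by (rule continuous_on_eq [OF w]) (simp only: nd)
  ultimately show "C_class a b n f" by (simp add: C_class_def)
qed

text \<open>\<open>J^(n-\<alpha>)\<close> lifts the equation to the integer order n, where
  differentiating n times recovers both functions.\<close>

lemma RL_integral_inject:
  assumes "continuous_on {a..b} f" "continuous_on {a..b} g" "\<alpha> \<ge> 0"
    and eq: "\<And>x. x \<in> {a..b} \<Longrightarrow> RL_integral a \<alpha> f x = RL_integral a \<alpha> g x"
    and x: "x \<in> {a..b}"
  shows "f x = g x"
proof -
  define n where "n = nat \<lceil>\<alpha>\<rceil>"
  have n: "real n - \<alpha> \<ge> 0" unfolding n_def by linarith
  have *: "RL_integral a (real n) h y = RL_integral a (real n - \<alpha>) (RL_integral a \<alpha> h) y"
    if "continuous_on {a..b} h" "y \<in> {a..b}" for h y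
    using RL_integral_RL_integral [OF ab that(1) n assms(3) that(2)] by simp
  have "RL_integral a (real n) f y = RL_integral a (real n) g y" if "y \<in> {a..b}" for y
    using that eq unfolding * [OF assms(1) that] * [OF assms(2) that] by - (rule RL_integral_cong, auto)
  hence "nth_deriv a b n (RL_integral a (real n) f) x = g x"
    using x by (intro nth_deriv_RL_integral [OF assms(2), where c = "\<lambda>_. 0"]) auto
  moreover have "nth_deriv a b n (RL_integral a (real n) f) x = f x"
    using x by (intro nth_deriv_RL_integral [OF assms(1), where c = "\<lambda>_. 0"]) auto
  ultimately show ?thesis by simp
qed

section \<open>Real orders: the two directions of the integral equation\<close>

lemma taylor_poly_ceiling:
  fixes \<alpha> :: real
  assumes "\<alpha> > 0"
  shows "taylor_poly a b (nat \<lceil>\<alpha>\<rceil> - 1) f t = (\<Sum>k<nat \<lceil>\<alpha>\<rceil>. nth_deriv a b k f a / fact k * (t - a) ^ k)"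
proof -
  have "{..nat \<lceil>\<alpha>\<rceil> - 1} = {..<nat \<lceil>\<alpha>\<rceil>}" using floor_ceiling_nat_order [OF assms] by auto
  thus ?thesis by (simp add: taylor_poly_def)
qed

text \<open>Here \<open>f - T = J^\<alpha> \<phi>\<close>, so
  \<open>J^(m-\<alpha>) (f - T) = J^m \<phi>\<close>, and m differentiations return \<phi>.\<close>

lemma
  assumes \<alpha>: "\<alpha> > 0" and C: "C_class a b (nat \<lceil>\<alpha>\<rceil> - 1) f" and \<phi>: "continuous_on {a..b} \<phi>"
    and eq: "\<And>x. x \<in> {a..b} \<Longrightarrow>
      f x = (\<Sum>k<nat \<lceil>\<alpha>\<rceil>. nth_deriv a b k f a / fact k * (x - a) ^ k) + RL_integral a \<alpha> \<phi> x"
  shows cont_caputo_differentiableI: "cont_caputo_differentiable a b \<alpha> f"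
    and caputo_deriv_eqI: "\<And>x. x \<in> {a..b} \<Longrightarrow> caputo_deriv a b \<alpha> f x = \<phi> x"
proof -
  define m where "m = nat \<lceil>\<alpha>\<rceil>"
  define R where "R = (\<lambda>t. f t - taylor_poly a b (nat \<lceil>\<alpha>\<rceil> - 1) f t)"
  note m = floor_ceiling_nat_order [OF \<alpha>, folded m_def]
  have R_eq: "R t = f t - (\<Sum>k<m. nth_deriv a b k f a / fact k * (t - a) ^ k)" for t
    unfolding R_def taylor_poly_ceiling [OF \<alpha>] m_def by (rule refl)
  \<comment> \<open>The zero polynomial is spelled out to fit the premise of
    \<open>nth_deriv_RL_integral\<close>.\<close>
  have R: "RL_integral a (real m - \<alpha>) R x = (\<Sum>k<m. 0 / fact k * (x - a) ^ k) + RL_integral a (real m) \<phi> x"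
    if x: "x \<in> {a..b}" for x
  proof -
    have "RL_integral a (real m - \<alpha>) R x = RL_integral a (real m - \<alpha>) (RL_integral a \<alpha> \<phi>) x"
      using x eq by - (rule RL_integral_cong, auto simp: R_eq m_def)
    also have "\<dots> = RL_integral a (real m) \<phi> x"
      using m \<alpha> x by (subst RL_integral_RL_integral [OF ab \<phi>]) auto
    finally show ?thesis by simp
  qed
  show deriv: "caputo_deriv a b \<alpha> f x = \<phi> x" if "x \<in> {a..b}" for x
    using nth_deriv_RL_integral [OF \<phi> R that]
    by (simp add: caputo_deriv_def RL_deriv_def Let_def R_def m_def)
  have "RL_differentiable a b \<alpha> R"
    using C_class_RL_integralI [OF \<phi> R]
    by (simp add: RL_differentiable_def Let_def m_def C_class_def)
  moreover have "continuous_on {a..b} (caputo_deriv a b \<alpha> f)"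
    by (rule continuous_on_eq [OF \<phi>]) (simp only: deriv)
  ultimately show "cont_caputo_differentiable a b \<alpha> f"
    using C by (simp add: cont_caputo_differentiable_def R_def)
qed

text \<open>With m = n + 1 and \<open>R = J^n w\<close>, commuting the integrals gives
  \<open>J^(m-\<alpha>) R = J^n v\<close> for \<open>v = J^(m-\<alpha>) w\<close>. Its n-th
  derivative is \<open>v\<close>, so one more gives \<open>v' = \<phi>\<close>; then
  \<open>v = J^1 \<phi>\<close>, and cancelling \<open>J^(m-\<alpha>)\<close> yields
  \<open>w\<close>.\<close>

lemma cont_caputo_differentiableD:
  assumes \<alpha>: "\<alpha> > 0" and f: "cont_caputo_differentiable a b \<alpha> f" and x: "x \<in> {a..b}"
  shows "f x = (\<Sum>k<nat \<lceil>\<alpha>\<rceil>. nth_deriv a b k f a / fact k * (x - a) ^ k)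
                 + RL_integral a \<alpha> (caputo_deriv a b \<alpha> f) x"
proof -
  define m where "m = nat \<lceil>\<alpha>\<rceil>"
  define R where "R = (\<lambda>t. f t - taylor_poly a b (nat \<lceil>\<alpha>\<rceil> - 1) f t)"
  define \<phi> where "\<phi> = caputo_deriv a b \<alpha> f"
  obtain n where mn: "m = Suc n"
    using floor_ceiling_nat_order(1) [OF \<alpha>] by (cases m) (auto simp: m_def)
  note m = floor_ceiling_nat_order [OF \<alpha>, folded m_def, unfolded mn]
  have C: "C_class a b n f" and td: "times_differentiable a b (Suc n) (RL_integral a (real m - \<alpha>) R)"
    and \<phi>: "continuous_on {a..b} \<phi>"
    and \<phi>_eq: "\<phi> = nth_deriv a b (Suc n) (RL_integral a (real m - \<alpha>) R)"
    using f mn unfolding cont_caputo_differentiable_def RL_differentiable_def caputo_deriv_def RL_deriv_def Let_def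
      \<phi>_def R_def m_def by auto
  have R_eq: "R t = f t - (\<Sum>k<Suc n. nth_deriv a b k f a / fact k * (t - a) ^ k)" for t
    unfolding mn [symmetric] m_def R_def taylor_poly_ceiling [OF \<alpha>] by (rule refl)
  \<comment> \<open>The top Taylor term is \<open>J^n\<close> of the constant
    \<open>D^n f(a)\<close>; subtracting that constant under \<open>J^n\<close> makes the remainder
    exactly \<open>J^n w\<close>.\<close>
  define w where "w t = nth_deriv a b n f t + (- nth_deriv a b n f a * 1)" for t
  have D: "continuous_on {a..b} (nth_deriv a b n f)" using C by (simp add: C_class_def)
  hence w: "continuous_on {a..b} w" unfolding w_def by (intro continuous_intros)
  have R: "R t = RL_integral a (real n) w t" if t: "t \<in> {a..b}" for t
  proof -
    have "RL_integral a (real n) w t = RL_integral a (real n) (nth_deriv a b n f) t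
        + RL_integral a (real n) (\<lambda>t. - nth_deriv a b n f a * 1) t"
      unfolding w_def using D t by (intro RL_integral_add [OF ab]) auto
    also have "RL_integral a (real n) (\<lambda>t. - nth_deriv a b n f a * 1) t
        = - nth_deriv a b n f a * ((t - a) ^ n / fact n)"
      using t by (simp only: RL_integral_cmult of_nat_0_le_iff RL_integral_monomial)
    also have "RL_integral a (real n) (nth_deriv a b n f) t =
        f t - (\<Sum>k<n. nth_deriv a b k f a / fact k * (t - a) ^ k)"
      using Taylor_RL_integral [OF C t] by simp
    finally show ?thesis
      by (simp add: R_eq)
  qed
  define v where "v = RL_integral a (real m - \<alpha>) w"
  have v: "continuous_on {a..b} v"
    unfolding v_def using w m mn by (intro continuous_on_RL_integral [OF ab]) auto
  have Jv: "RL_integral a (real m - \<alpha>) R t = (\<Sum>k<n. 0 / fact k * (t - a) ^ k) + RL_integral a (real n) v t"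
    if t: "t \<in> {a..b}" for t
  proof -
    have "RL_integral a (real m - \<alpha>) R t = RL_integral a (real m - \<alpha>) (RL_integral a (real n) w) t"
      using t R by - (rule RL_integral_cong, auto)
    also have "\<dots> = RL_integral a (real n) v t"
      unfolding v_def using t m mn w by (simp add: RL_integral_RL_integral [OF ab] add.commute)
    finally show ?thesis by simp
  qed
  \<comment> \<open>For m > \<alpha> a fractional integral vanishes at \<open>a\<close>; for m =
    \<alpha> one has v = w, and \<open>w\<close> vanishes there by construction.\<close>
  have "v a = 0"
    using RL_integral_at_start [of "real m - \<alpha>" a w] m mn by (cases "real m = \<alpha>") (auto simp: v_def w_def)
  have v_deriv: "(v has_vector_derivative \<phi> t) (at t within {a..b})" if t: "t \<in> {a..b}" for t
    unfolding \<phi>_eq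
    by (rule has_vector_derivative_transform [OF t nth_deriv_RL_integral [OF v Jv, symmetric]
          nth_deriv_has_vector_derivative [OF td lessI t]])
  hence v_eq: "v t = RL_integral a 1 \<phi> t" if "t \<in> {a..b}" for t
    using RL_integral_1_derivative [OF ab v_deriv \<phi> that] \<open>v a = 0\<close> by simp
  \<comment> \<open>The orders fit because (m - \<alpha>) + (\<alpha> - n) = 1.\<close>
  have "w t = RL_integral a (\<alpha> - real n) \<phi> t" if "t \<in> {a..b}" for t
  proof (rule RL_integral_inject [where \<alpha> = "real m - \<alpha>", OF w _ _ _ that])
    show "RL_integral a (real m - \<alpha>) w y = RL_integral a (real m - \<alpha>) (RL_integral a (\<alpha> - real n) \<phi>) y"
      if "y \<in> {a..b}" for y
      using v_eq [OF that] that m mn by (simp add: RL_integral_RL_integral [OF ab \<phi>] v_def)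
  qed (use \<phi> m mn in \<open>auto intro!: continuous_on_RL_integral [OF ab]\<close>)
  hence "R x = RL_integral a (real n) (RL_integral a (\<alpha> - real n) \<phi>) x"
    unfolding R [OF x] using x by - (rule RL_integral_cong, auto)
  also have "\<dots> = RL_integral a \<alpha> \<phi> x"
    using x m by (subst RL_integral_RL_integral [OF ab \<phi>]) auto
  finally show ?thesis
    by (simp add: R_eq m_def [symmetric] mn \<phi>_def)
qed

end

subsection \<open>Changing the order\<close>

context
  fixes a b :: real
  assumes ab: "a < b"
begin

lemma RL_integral_sum:
  assumes "finite A" "\<And>k. k \<in> A \<Longrightarrow> continuous_on {a..b} (f k)" "\<alpha> \<ge> 0" "x \<in> {a..b}"
  shows "RL_integral a \<alpha> (\<lambda>t. \<Sum>k\<in>A. f k t) x = (\<Sum>k\<in>A. RL_integral a \<alpha> (f k) x)"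
  using assms(1,2)
proof (induction rule: finite_induct)
  case empty
  show ?case using RL_integral_cmult [OF assms(3), of a 0 "\<lambda>_. 0" x] by simp
next
  case (insert k A)
  have "RL_integral a \<alpha> (\<lambda>t. f k t + (\<Sum>k\<in>A. f k t)) x
      = RL_integral a \<alpha> (f k) x + RL_integral a \<alpha> (\<lambda>t. \<Sum>k\<in>A. f k t) x"
    using insert.prems assms(3,4) by (intro RL_integral_add [OF ab] continuous_on_sum) blast+
  thus ?case using insert by simp
qed

text \<open>The Taylor monomial of degree \<open>k\<close> is \<open>J\<^sup>k 1 = J\<^sup>\<beta> (J\<^sup>k\<^sup>-\<^sup>\<beta> 1)\<close> for \<open>k \<ge> \<beta>\<close>, so the Taylor terms
  of degree at least \<open>\<lceil>\<beta>\<rceil>\<close> are absorbed into the \<open>\<beta>\<close>-derivative \<open>\<psi>\<close>.\<close>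

lemma
  assumes \<alpha>: "\<alpha> > 0" and f: "cont_caputo_differentiable a b \<alpha> f" and \<beta>: "0 < \<beta>" "\<beta> < \<alpha>"
  shows cont_caputo_differentiable_lower: "cont_caputo_differentiable a b \<beta> f"
    and caputo_deriv_lower_at_start: "\<beta> \<notin> \<nat> \<Longrightarrow> caputo_deriv a b \<beta> f a = 0"
proof -
  define m where "m = nat \<lceil>\<alpha>\<rceil>"
  define n where "n = nat \<lceil>\<beta>\<rceil>"
  define d where "d k = nth_deriv a b k f a" for k
  define \<phi> where "\<phi> = caputo_deriv a b \<alpha> f"
  define \<psi> where "\<psi> t = (\<Sum>k=n..<m. d k * RL_integral a (real k - \<beta>) (\<lambda>_. 1) t)
      + RL_integral a (\<alpha> - \<beta>) \<phi> t" for t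
  have nm: "n \<le> m" using \<beta> unfolding m_def n_def by (intro nat_mono ceiling_mono) simp
  have k\<beta>: "real k - \<beta> \<ge> 0" if "n \<le> k" for k
    using that floor_ceiling_nat_order(2) [OF \<beta>(1)] unfolding n_def [symmetric] by linarith
  have \<phi>: "continuous_on {a..b} \<phi>"
    using f by (simp add: cont_caputo_differentiable_def \<phi>_def)
  have mon: "continuous_on {a..b} (\<lambda>t. d k * RL_integral a (real k - \<beta>) (\<lambda>_. 1) t)" if "n \<le> k" for k
    by (intro continuous_on_mult_left continuous_on_RL_integral [OF ab continuous_on_const] k\<beta> that)
  have sum: "continuous_on {a..b} (\<lambda>t. \<Sum>k=n..<m. d k * RL_integral a (real k - \<beta>) (\<lambda>_. 1) t)"
    by (rule continuous_on_sum, rule mon) simp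
  have rem: "continuous_on {a..b} (RL_integral a (\<alpha> - \<beta>) \<phi>)"
    using \<beta> by (intro continuous_on_RL_integral [OF ab \<phi>]) simp
  have \<psi>: "continuous_on {a..b} \<psi>"
    unfolding \<psi>_def by (intro continuous_on_add sum rem)
  have C: "C_class a b (n - 1) f"
  proof (rule C_class_mono [OF ab])
    show "C_class a b (m - 1) f"
      using f unfolding cont_caputo_differentiable_def m_def by (rule conjunct1)
  qed (use nm in simp)
  have eq: "f x = (\<Sum>k<n. d k / fact k * (x - a) ^ k) + RL_integral a \<beta> \<psi> x" if x: "x \<in> {a..b}" for x
  proof -
    have "RL_integral a \<beta> \<psi> x = (\<Sum>k=n..<m. RL_integral a \<beta> (\<lambda>t. d k * RL_integral a (real k - \<beta>) (\<lambda>_. 1) t) x)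
        + RL_integral a \<beta> (RL_integral a (\<alpha> - \<beta>) \<phi>) x"
    proof -
      have "RL_integral a \<beta> \<psi> x
          = RL_integral a \<beta> (\<lambda>t. \<Sum>k=n..<m. d k * RL_integral a (real k - \<beta>) (\<lambda>_. 1) t) x
            + RL_integral a \<beta> (RL_integral a (\<alpha> - \<beta>) \<phi>) x"
        unfolding \<psi>_def [abs_def] using sum rem less_imp_le [OF \<beta>(1)] x by (rule RL_integral_add [OF ab])
      also have "RL_integral a \<beta> (\<lambda>t. \<Sum>k=n..<m. d k * RL_integral a (real k - \<beta>) (\<lambda>_. 1) t) x
          = (\<Sum>k=n..<m. RL_integral a \<beta> (\<lambda>t. d k * RL_integral a (real k - \<beta>) (\<lambda>_. 1) t) x)"
        using \<beta> x by (intro RL_integral_sum mon) auto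
      finally show ?thesis .
    qed
    also have "RL_integral a \<beta> (RL_integral a (\<alpha> - \<beta>) \<phi>) x = RL_integral a \<alpha> \<phi> x"
      using \<beta> RL_integral_RL_integral [OF ab \<phi>, of \<beta> "\<alpha> - \<beta>" x] x by simp
    also have "(\<Sum>k=n..<m. RL_integral a \<beta> (\<lambda>t. d k * RL_integral a (real k - \<beta>) (\<lambda>_. 1) t) x)
        = (\<Sum>k=n..<m. d k / fact k * (x - a) ^ k)"
    proof (rule sum.cong [OF refl])
      fix k assume k: "k \<in> {n..<m}"
      have "RL_integral a \<beta> (RL_integral a (real k - \<beta>) (\<lambda>_. 1)) x = (x - a) ^ k / fact k"
        using RL_integral_RL_integral [OF ab continuous_on_const less_imp_le [OF \<beta>(1)] k\<beta> x, of k 1] k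
        by (simp add: RL_integral_monomial [OF ab x])
      thus "RL_integral a \<beta> (\<lambda>t. d k * RL_integral a (real k - \<beta>) (\<lambda>_. 1) t) x = d k / fact k * (x - a) ^ k"
        using \<beta> by (simp add: RL_integral_cmult)
    qed
    finally have "RL_integral a \<beta> \<psi> x = (\<Sum>k=n..<m. d k / fact k * (x - a) ^ k) + RL_integral a \<alpha> \<phi> x" .
    moreover have "f x = (\<Sum>k<m. d k / fact k * (x - a) ^ k) + RL_integral a \<alpha> \<phi> x"
      using cont_caputo_differentiableD [OF ab \<alpha> f x] by (simp add: m_def d_def \<phi>_def)
    moreover have "(\<Sum>k<m. d k / fact k * (x - a) ^ k)
        = (\<Sum>k<n. d k / fact k * (x - a) ^ k) + (\<Sum>k=n..<m. d k / fact k * (x - a) ^ k)"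
      using sum.atLeastLessThan_concat [of 0 n m "\<lambda>k. d k / fact k * (x - a) ^ k"] nm
      by (simp add: atLeast0LessThan)
    ultimately show ?thesis by simp
  qed
  note eq = eq [unfolded d_def n_def]
  show "cont_caputo_differentiable a b \<beta> f"
    by (rule cont_caputo_differentiableI [OF ab \<beta>(1) C [unfolded n_def] \<psi> eq])
  show "caputo_deriv a b \<beta> f a = 0" if "\<beta> \<notin> \<nat>"
  proof -
    \<comment> \<open>For fractional \<beta> every order k - \<beta> is positive, so each term
      vanishes at \<open>a\<close>. For natural \<beta> the term k = n would be
      \<open>J^0 1 = 1\<close> and contribute \<open>d n\<close>.\<close>
    have "RL_integral a (real k - \<beta>) (\<lambda>_. 1) a = 0" if "n \<le> k" for k
    proof (rule RL_integral_at_start)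
      have "\<beta> \<noteq> real k" using \<open>\<beta> \<notin> \<nat>\<close> by auto
      thus "real k - \<beta> > 0" using k\<beta> [OF that] by linarith
    qed
    hence "(\<Sum>k=n..<m. d k * RL_integral a (real k - \<beta>) (\<lambda>_. 1) a) = 0"
      by (intro sum.neutral) simp
    hence "\<psi> a = 0"
      using \<beta> by (simp add: \<psi>_def RL_integral_at_start)
    thus ?thesis
      using caputo_deriv_eqI [OF ab \<beta>(1) C [unfolded n_def] \<psi> eq, of a] ab by simp
  qed
qed

section \<open>Composition of Caputo derivatives\<close>

text \<open>Comparing the integral equations of orders \<beta> and \<beta> + \<gamma> for the same
  \<open>f\<close> gives \<open>J^\<beta> \<psi> = J^\<beta> (c + J^\<gamma> \<theta>)\<close>.
  Cancelling \<open>J^\<beta>\<close> leaves the integral equation of order \<gamma> for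
  \<psi>.\<close>

lemma
  assumes f: "cont_caputo_differentiable a b \<beta> f" "cont_caputo_differentiable a b (\<beta> + \<gamma>) f"
    and \<beta>: "0 < \<beta>" and \<gamma>: "0 < \<gamma>" "\<gamma> \<le> 1" and ceil: "\<lceil>\<beta> + \<gamma>\<rceil> - \<lfloor>\<beta>\<rfloor> = 1"
  shows cont_caputo_differentiable_caputo_deriv: "cont_caputo_differentiable a b \<gamma> (caputo_deriv a b \<beta> f)"
    and caputo_deriv_caputo_deriv:
      "\<And>x. x \<in> {a..b} \<Longrightarrow> caputo_deriv a b \<gamma> (caputo_deriv a b \<beta> f) x = caputo_deriv a b (\<beta> + \<gamma>) f x"
proof -
  define n where "n = nat \<lceil>\<beta>\<rceil>"
  define \<psi> where "\<psi> = caputo_deriv a b \<beta> f"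
  define \<theta> where "\<theta> = caputo_deriv a b (\<beta> + \<gamma>) f"
  \<comment> \<open>For natural \<beta> = n the longer Taylor polynomial has one extra term, which
    is \<open>J^n\<close> of the constant \<open>D^n f(a)\<close>; for fractional \<beta> the
    polynomials coincide.\<close>
  define c where "c = (if \<beta> \<in> \<nat> then nth_deriv a b n f a else 0)"
  note ceil = nat_ceiling_sum [OF \<beta> \<gamma>(1) ceil, folded n_def]
  have \<psi>: "continuous_on {a..b} \<psi>" and \<theta>: "continuous_on {a..b} \<theta>"
    using f by (auto simp: cont_caputo_differentiable_def \<psi>_def \<theta>_def)
  have J\<theta>: "continuous_on {a..b} (RL_integral a \<gamma> \<theta>)"
    using \<theta> \<gamma> by (intro continuous_on_RL_integral [OF ab]) auto
  have "RL_integral a \<beta> \<psi> x = RL_integral a \<beta> (\<lambda>t. c * 1 + RL_integral a \<gamma> \<theta> t) x" if x: "x \<in> {a..b}" for x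
  proof -
    have "RL_integral a \<beta> (\<lambda>t. c * 1 + RL_integral a \<gamma> \<theta> t) x
        = RL_integral a \<beta> (\<lambda>t. c * 1) x + RL_integral a \<beta> (RL_integral a \<gamma> \<theta>) x"
      using x J\<theta> \<beta> by (intro RL_integral_add [OF ab]) auto
    also have "RL_integral a \<beta> (RL_integral a \<gamma> \<theta>) x = RL_integral a (\<beta> + \<gamma>) \<theta> x"
      using x \<theta> \<beta> \<gamma> by (intro RL_integral_RL_integral [OF ab]) auto
    also have "RL_integral a \<beta> (\<lambda>t. c * 1) x = (if \<beta> \<in> \<nat> then nth_deriv a b n f a / fact n * (x - a) ^ n else 0)"
      using ceil(3) RL_integral_monomial [OF ab x, of n] \<beta> RL_integral_cmult [of \<beta> a c "\<lambda>_. 1" x]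
      by (auto simp: c_def)
    finally have "RL_integral a \<beta> (\<lambda>t. c * 1 + RL_integral a \<gamma> \<theta> t) x = \<dots> + RL_integral a (\<beta> + \<gamma>) \<theta> x" .
    moreover have "(\<Sum>k<n. nth_deriv a b k f a / fact k * (x - a) ^ k) + RL_integral a \<beta> \<psi> x
        = (\<Sum>k<nat \<lceil>\<beta> + \<gamma>\<rceil>. nth_deriv a b k f a / fact k * (x - a) ^ k) + RL_integral a (\<beta> + \<gamma>) \<theta> x"
      using cont_caputo_differentiableD [OF ab \<beta> f(1) x] cont_caputo_differentiableD [OF ab _ f(2) x] \<beta> \<gamma>
      by (simp add: n_def \<psi>_def \<theta>_def)
    ultimately show ?thesis
      using ceil(1,2) by (cases "\<beta> \<in> \<nat>") simp_all
  qed
  hence \<psi>_eq: "\<psi> x = c * 1 + RL_integral a \<gamma> \<theta> x" if "x \<in> {a..b}" for x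
    using \<psi> J\<theta> \<beta> that
    by (intro RL_integral_inject [OF ab, where \<alpha> = \<beta> and g = "\<lambda>t. c * 1 + RL_integral a \<gamma> \<theta> t"] continuous_intros) auto
  have "\<psi> a = c" using \<psi>_eq [of a] ab \<gamma> by (simp add: RL_integral_at_start)
  \<comment> \<open>Hence the Taylor polynomial of \<psi> is just its value at \<open>a\<close>,
    which is \<open>c\<close>.\<close>
  have 1: "nat \<lceil>\<gamma>\<rceil> = 1" using \<gamma> by linarith
  have C: "C_class a b (nat \<lceil>\<gamma>\<rceil> - 1) \<psi>"
    using \<psi> by (simp add: 1 C_class_def times_differentiable_def)
  have eq: "\<psi> x = (\<Sum>k<nat \<lceil>\<gamma>\<rceil>. nth_deriv a b k \<psi> a / fact k * (x - a) ^ k) + RL_integral a \<gamma> \<theta> x"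
    if "x \<in> {a..b}" for x
    using \<psi>_eq [OF that] \<open>\<psi> a = c\<close> by (simp add: 1)
  show "cont_caputo_differentiable a b \<gamma> (caputo_deriv a b \<beta> f)"
    using cont_caputo_differentiableI [OF ab \<gamma>(1) C \<theta> eq] by (simp add: \<psi>_def)
  show "caputo_deriv a b \<gamma> (caputo_deriv a b \<beta> f) x = caputo_deriv a b (\<beta> + \<gamma>) f x" if "x \<in> {a..b}" for x
    using caputo_deriv_eqI [OF ab \<gamma>(1) C \<theta> eq that] by (simp add: \<psi>_def \<theta>_def)
qed

text \<open>Inserting \<open>\<psi> = \<psi>(a) + J^\<gamma> \<theta>\<close> into the equation for
  \<open>h\<close> leaves the extra summand \<open>\<psi>(a) J^\<beta> 1\<close>. For natural
  \<beta> it is the missing Taylor term; for fractional \<beta> the hypothesis \<open>zero\<close>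
  removes it.\<close>

lemma cont_caputo_differentiable_sum_order:
  assumes h: "cont_caputo_differentiable a b \<beta> h"
    and h1: "cont_caputo_differentiable a b \<gamma> (caputo_deriv a b \<beta> h)"
    and zero: "\<beta> \<notin> \<nat> \<Longrightarrow> caputo_deriv a b \<beta> h a = 0"
    and \<beta>: "0 < \<beta>" and \<gamma>: "0 < \<gamma>" "\<gamma> \<le> 1" and ceil: "\<lceil>\<beta> + \<gamma>\<rceil> - \<lfloor>\<beta>\<rfloor> = 1"
  shows "cont_caputo_differentiable a b (\<beta> + \<gamma>) h"
proof -
  define n where "n = nat \<lceil>\<beta>\<rceil>"
  define \<psi> where "\<psi> = caputo_deriv a b \<beta> h"
  define \<theta> where "\<theta> = caputo_deriv a b \<gamma> \<psi>"
  define d where "d k = nth_deriv a b k h a" for k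
  note ceil = nat_ceiling_sum [OF \<beta> \<gamma>(1) ceil, folded n_def]
  have \<psi>: "continuous_on {a..b} \<psi>" and \<theta>: "continuous_on {a..b} \<theta>"
    using h h1 by (auto simp: cont_caputo_differentiable_def \<psi>_def \<theta>_def)
  have J\<theta>: "continuous_on {a..b} (RL_integral a \<gamma> \<theta>)"
    using \<theta> \<gamma> by (intro continuous_on_RL_integral [OF ab]) auto
  have h_eq: "h x = (\<Sum>k<n. d k / fact k * (x - a) ^ k) + RL_integral a \<beta> \<psi> x" if "x \<in> {a..b}" for x
    using cont_caputo_differentiableD [OF ab \<beta> h that] by (simp add: n_def \<psi>_def d_def)
  have 1: "nat \<lceil>\<gamma>\<rceil> = 1" using \<gamma> by linarith
  have \<psi>_eq: "\<psi> x = \<psi> a * 1 + RL_integral a \<gamma> \<theta> x" if "x \<in> {a..b}" for x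
  proof -
    have "\<psi> x = (\<Sum>k<nat \<lceil>\<gamma>\<rceil>. nth_deriv a b k \<psi> a / fact k * (x - a) ^ k) + RL_integral a \<gamma> \<theta> x"
      unfolding \<theta>_def \<psi>_def by (rule cont_caputo_differentiableD [OF ab \<gamma>(1) h1 that])
    also have "\<dots> = \<psi> a * 1 + RL_integral a \<gamma> \<theta> x"
      by (simp add: 1)
    finally show ?thesis .
  qed
  have J\<psi>: "RL_integral a \<beta> \<psi> x = \<psi> a * RL_integral a \<beta> (\<lambda>_. 1) x + RL_integral a (\<beta> + \<gamma>) \<theta> x"
    if x: "x \<in> {a..b}" for x
  proof -
    have "RL_integral a \<beta> \<psi> x = RL_integral a \<beta> (\<lambda>t. \<psi> a * 1 + RL_integral a \<gamma> \<theta> t) x"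
      by (rule RL_integral_cong, rule \<psi>_eq) (use x in auto)
    also have "\<dots> = RL_integral a \<beta> (\<lambda>t. \<psi> a * 1) x + RL_integral a \<beta> (RL_integral a \<gamma> \<theta>) x"
      using x J\<theta> \<beta> by (intro RL_integral_add [OF ab]) auto
    also have "RL_integral a \<beta> (RL_integral a \<gamma> \<theta>) x = RL_integral a (\<beta> + \<gamma>) \<theta> x"
      using x \<theta> \<beta> \<gamma> by (intro RL_integral_RL_integral [OF ab]) auto
    finally show ?thesis
      using \<beta> by (simp only: RL_integral_cmult less_imp_le)
  qed
  have "C_class a b (nat \<lceil>\<beta> + \<gamma>\<rceil> - 1) h \<and>
      (\<forall>x\<in>{a..b}. h x = (\<Sum>k<nat \<lceil>\<beta> + \<gamma>\<rceil>. d k / fact k * (x - a) ^ k) + RL_integral a (\<beta> + \<gamma>) \<theta> x)"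
  proof (cases "\<beta> \<in> \<nat>")
    case False
    thus ?thesis
      using h h_eq J\<psi> zero ceil(1) by (simp add: cont_caputo_differentiable_def n_def \<psi>_def)
  next
    case True
    have n: "real n = \<beta>" using ceil(3) True by simp
    \<comment> \<open>With \<beta> = n the equation for \<open>h\<close> has integer order, so
      \<open>h\<close> is of class C^n with n-th derivative \<psi>. This supplies both the extra
      regularity required by the order \<beta> + \<gamma> and the extra coefficient.\<close>
    note h' = h_eq [folded n]
    have "d n = \<psi> a"
      unfolding d_def using ab by (intro nth_deriv_RL_integral [OF ab \<psi> h']) auto
    moreover have "C_class a b n h"
      by (rule C_class_RL_integralI [OF ab \<psi> h'])
    moreover have "RL_integral a \<beta> (\<lambda>_. 1) x = (x - a) ^ n / fact n" if "x \<in> {a..b}" for x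
      using RL_integral_monomial [OF ab that, of n] n by simp
    ultimately show ?thesis
      using h_eq J\<psi> ceil(2) True by simp
  qed
  thus ?thesis
    using \<beta> \<gamma> \<theta> by (intro cont_caputo_differentiableI [OF ab, where \<phi> = \<theta>]) (auto simp: d_def)
qed

end

theorem theorem9:
  fixes a b :: real
  assumes "a < b"
  shows
    "(\<forall>(\<alpha>::real) (f :: real \<Rightarrow> real).
        \<alpha> > 0 \<and> C_class a b (nat \<lceil>\<alpha>\<rceil> - 1) f \<and> cont_caputo_differentiable a b \<alpha> f \<longrightarrow>
        (\<forall>\<beta>. 0 < \<beta> \<and> \<beta> < \<alpha> \<longrightarrow>
           cont_caputo_differentiable a b \<beta> f \<and>
           continuous_on {a..b} (caputo_deriv a b \<beta> f) \<and>
           (\<beta> \<notin> \<nat> \<longrightarrow> caputo_deriv a b \<beta> f a = 0)) \<and>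
        (\<forall>\<beta> \<gamma>. 0 < \<beta> \<and> \<beta> < \<alpha> \<and> 0 < \<gamma> \<and> \<gamma> \<le> 1 \<and> \<beta> + \<gamma> \<le> \<alpha> \<and> \<lceil>\<beta> + \<gamma>\<rceil> - \<lfloor>\<beta>\<rfloor> = 1 \<longrightarrow>
           cont_caputo_differentiable a b \<gamma> (caputo_deriv a b \<beta> f) \<and>
           (\<forall>x\<in>{a..b}. caputo_deriv a b \<gamma> (caputo_deriv a b \<beta> f) x
                        = caputo_deriv a b (\<beta> + \<gamma>) f x)))
     \<and>
     (\<forall>(\<beta>::real) (\<gamma>::real) (h :: real \<Rightarrow> real).
        \<beta> > 0 \<and> 0 < \<gamma> \<and> \<gamma> \<le> 1 \<and> \<lceil>\<beta> + \<gamma>\<rceil> - \<lfloor>\<beta>\<rfloor> = 1 \<and>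
        C_class a b (nat \<lceil>\<beta>\<rceil> - 1) h \<and> cont_caputo_differentiable a b \<beta> h \<and>
        cont_caputo_differentiable a b \<gamma> (caputo_deriv a b \<beta> h) \<and>
        (\<beta> \<notin> \<nat> \<longrightarrow> caputo_deriv a b \<beta> h a = 0) \<longrightarrow>
        cont_caputo_differentiable a b (\<beta> + \<gamma>) h \<and>
        (\<forall>x\<in>{a..b}. caputo_deriv a b \<gamma> (caputo_deriv a b \<beta> h) x
                     = caputo_deriv a b (\<beta> + \<gamma>) h x))"
proof (intro conjI allI impI ballI; (elim conjE)?)
  fix \<alpha> \<beta> :: real and f :: "real \<Rightarrow> real"
  assume \<alpha>: "\<alpha> > 0" and f: "cont_caputo_differentiable a b \<alpha> f" and \<beta>: "0 < \<beta>" "\<beta> < \<alpha>"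
  show *: "cont_caputo_differentiable a b \<beta> f"
    by (rule cont_caputo_differentiable_lower [OF assms \<alpha> f \<beta>])
  show "continuous_on {a..b} (caputo_deriv a b \<beta> f)"
    using * by (simp add: cont_caputo_differentiable_def)
  show "caputo_deriv a b \<beta> f a = 0" if "\<beta> \<notin> \<nat>"
    by (rule caputo_deriv_lower_at_start [OF assms \<alpha> f \<beta> that])
next
  fix \<alpha> \<beta> \<gamma> :: real and f :: "real \<Rightarrow> real"
  assume \<alpha>: "\<alpha> > 0" and f: "cont_caputo_differentiable a b \<alpha> f" and \<beta>: "0 < \<beta>" "\<beta> < \<alpha>"
    and \<gamma>: "0 < \<gamma>" "\<gamma> \<le> 1" "\<beta> + \<gamma> \<le> \<alpha>" and ceil: "\<lceil>\<beta> + \<gamma>\<rceil> - \<lfloor>\<beta>\<rfloor> = 1"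
  have f\<beta>: "cont_caputo_differentiable a b \<beta> f"
    by (rule cont_caputo_differentiable_lower [OF assms \<alpha> f \<beta>])
  \<comment> \<open>Lowering the order covers \<beta> + \<gamma> < \<alpha>; in the case of equality
    this is the assumption on \<open>f\<close>.\<close>
  have f\<beta>\<gamma>: "cont_caputo_differentiable a b (\<beta> + \<gamma>) f"
    using cont_caputo_differentiable_lower [OF assms \<alpha> f, of "\<beta> + \<gamma>"] f \<beta> \<gamma>
    by (cases "\<beta> + \<gamma> = \<alpha>") auto
  show "cont_caputo_differentiable a b \<gamma> (caputo_deriv a b \<beta> f)"
    by (rule cont_caputo_differentiable_caputo_deriv [OF assms f\<beta> f\<beta>\<gamma> \<beta>(1) \<gamma>(1,2) ceil])
  show "caputo_deriv a b \<gamma> (caputo_deriv a b \<beta> f) x = caputo_deriv a b (\<beta> + \<gamma>) f x"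
    if "x \<in> {a..b}" for x
    by (rule caputo_deriv_caputo_deriv [OF assms f\<beta> f\<beta>\<gamma> \<beta>(1) \<gamma>(1,2) ceil that])
next
  fix \<beta> \<gamma> :: real and h :: "real \<Rightarrow> real"
  assume \<beta>: "\<beta> > 0" and \<gamma>: "0 < \<gamma>" "\<gamma> \<le> 1" and ceil: "\<lceil>\<beta> + \<gamma>\<rceil> - \<lfloor>\<beta>\<rfloor> = 1"
    and h: "cont_caputo_differentiable a b \<beta> h"
    and h1: "cont_caputo_differentiable a b \<gamma> (caputo_deriv a b \<beta> h)"
    and zero: "\<beta> \<notin> \<nat> \<longrightarrow> caputo_deriv a b \<beta> h a = 0"
  show *: "cont_caputo_differentiable a b (\<beta> + \<gamma>) h"
    using zero by (intro cont_caputo_differentiable_sum_order [OF assms h h1 _ \<beta> \<gamma> ceil]) auto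
  \<comment> \<open>With both orders now available for \<open>h\<close>, the identity is the one
    from the direct part.\<close>
  show "caputo_deriv a b \<gamma> (caputo_deriv a b \<beta> h) x = caputo_deriv a b (\<beta> + \<gamma>) h x"
    if "x \<in> {a..b}" for x
    by (rule caputo_deriv_caputo_deriv [OF assms h * \<beta> \<gamma> ceil that])
qed

end
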